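(* Let $N_{\rm b}\ge 1$ and $N_{\rm t}\ge 1$ be integers and let $\mathbb S$ (the array UF-3BL) be the union of the six sub-ULAs $\{I,S,N\}$ (initial position, interspace, number of sensors) $$\begin{aligned} &\text{sub-ULA1}: \{0,\,3,\,N_{\rm b}\},\\ &\text{sub-ULA2}: \{3N_{\rm b}+1,\,1,\,2\},\\ &\text{sub-ULA3}: \{6N_{\rm b}+4,\,3N_{\rm b}+5,\,N_{\rm t}\},\\ &\text{sub-ULA4}: \{3N_{\rm t}N_{\rm b}+5N_{\rm t}+3N_{\rm b}+2,\,3,\,N_{\rm b}\},\\ &\text{sub-ULA5}: \{3N_{\rm t}N_{\rm b}+5N_{\rm t}+6N_{\rm b}+3,\,2,\,2\},\\ &\text{sub-ULA6}: \{3N_{\rm t}N_{\rm b}+5N_{\rm t}+6N_{\rm b}+8,\,3,\,N_{\rm b}\}, \end{aligned}$$ which has $N=3N_{\rm b}+N_{\rm t}+4$ sensors in total. Then: (1) The maximal set of consecutive integers $\{0,1,\dots,J\}$ starting at $0$ and contained in the difference coarray of $\mathbb S$ has $J=3N_{\rm b}N_{\rm t}+5N_{\rm t}+3N_{\rm b}-1$; hence $\mathrm{uDOF}(\mathbb S)=2J+1$ with this $J$. (2) The weight function of $\mathbb S$ satisfies $w(1)=1$, $w(2)=1$, $w(3)=3N_{\rm b}-1$. (3) For every fixed integer $N\ge 17$, the quantity $3N_{\rm b}N_{\rm t}+5N_{\rm t}+3N_{\rm b}-1$ is maximized over positive integers $N_{\rm b},N_{\rm t}$ subject to $3N_{\rm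 b}+N_{\rm t}+4=N$ by the choice $$N_{\rm b}=\Big\lfloor \frac{N-5}{6}\Big\rfloor,\qquad N_{\rm t}=N-3N_{\rm b}-4,$$ and with this choice $$\mathrm{uDOF}(\mathbb S)=\begin{cases}\frac{N^2}{2}+2N-11, & N \bmod 6\in\{0,4\},\\[2pt] \frac{N^2}{2}+2N-9.5, & N\bmod 6\in\{1,3\},\\[2pt] \frac{N^2}{2}+2N-9, & N\bmod 6=2,\\[2pt] \frac{N^2}{2}+2N-13.5, & N\bmod 6=5.\end{cases}$$
   Context: A (normalized) sparse linear array is a finite set $\mathbb S\subset\mathbb Z_{\ge 0}$ of sensor positions. A (sub-)ULA with parameters $\{I,S,N\}$ is the set $\{I, I+S, \dots, I+(N-1)S\}$, where $I$ is the initial position, $S\ge 1$ the interspace, and $N$ the number of sensors. The difference coarray (DCA) of $\mathbb S$ is $\mathbb D=\{p-q : p,q\in\mathbb S\}$. The central ULA of $\mathbb D$ is the largest set of consecutive integers $\{-J,\dots,J\}$ contained in $\mathbb D$, and the uniform degrees of freedom $\mathrm{uDOF}(\mathbb S)$ is its cardinality $2J+1$. The weight function $w(n)$, for an integer $n\ge 1$, is the number of pairs $(p,q)\in\mathbb S\times\mathbb S$ with $p-q=n$. *)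

theory Defs
  imports Complex_Main
begin

definition sub_ula :: "nat \<Rightarrow> nat \<Rightarrow> nat \<Rightarrow> nat set" where
  "sub_ula I S N = {I + k * S | k. k < N}"

definition dca :: "nat set \<Rightarrow> int set" where
  "dca A = {int p - int q | p q. p \<in> A \<and> q \<in> A}"

(* For a finite nonempty A the set of admissible J is bounded and contains 0, so the
   GREATEST operator picks a genuine maximum; outside that case it is unspecified. *)
definition central_ula :: "nat set \<Rightarrow> int set" where
  "central_ula A =
     (let J = (GREATEST J :: nat. {- int J .. int J} \<subseteq> dca A) in {- int J .. int J})"

definition uDOF :: "nat set \<Rightarrow> nat" where
  "uDOF A = card (central_ula A)"

definition weight :: "nat set \<Rightarrow> int \<Rightarrow> nat" where
  "weight A n = card {(p, q). p \<in> A \<and> q \<in> A \<and> int p - int q = n}"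

definition uf_3bl :: "nat \<Rightarrow> nat \<Rightarrow> nat set" where
  "uf_3bl Nb Nt =
     sub_ula 0 3 Nb \<union>
     sub_ula (3 * Nb + 1) 1 2 \<union>
     sub_ula (6 * Nb + 4) (3 * Nb + 5) Nt \<union>
     sub_ula (3 * Nt * Nb + 5 * Nt + 3 * Nb + 2) 3 Nb \<union>
     sub_ula (3 * Nt * Nb + 5 * Nt + 6 * Nb + 3) 2 2 \<union>
     sub_ula (3 * Nt * Nb + 5 * Nt + 6 * Nb + 8) 3 Nb"

definition uf_3bl_J :: "nat \<Rightarrow> nat \<Rightarrow> int" where
  "uf_3bl_J Nb Nt = 3 * int Nb * int Nt + 5 * int Nt + 3 * int Nb - 1"

end

theory Submission
  imports Defs
begin

section \<open>Positions and size of the array\<close>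

lemma card_sub_ula: "S > 0 \<Longrightarrow> card (sub_ula I S N) = N"
proof -
  assume "S > 0"
  moreover have "sub_ula I S N = (\<lambda>k. I + k * S) ` {..<N}"
    by (auto simp: sub_ula_def)
  ultimately show ?thesis
    by (simp add: card_image inj_on_def)
qed

lemma finite_sub_ula: "finite (sub_ula I S N)"
  by (simp add: sub_ula_def)

text \<open>Naming the product \<open>A\<close> makes the bilinear offsets of sub-ULA4 to sub-ULA6
  linear in \<open>A\<close> and \<open>b\<close>, within reach of linear arithmetic.\<close>

lemma mem_uf_3bl_iff:
  assumes "A = (3 * b + 5) * t"
  shows "n \<in> uf_3bl b t \<longleftrightarrow>
    (\<exists>i<b. n = 3 * i) \<or> n = 3 * b + 1 \<or> n = 3 * b + 2 \<or>
    (\<exists>j<t. n = 6 * b + 4 + (3 * b + 5) * j) \<or>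
    (\<exists>i<b. n = A + 3 * b + 2 + 3 * i) \<or> n = A + 6 * b + 3 \<or> n = A + 6 * b + 5 \<or>
    (\<exists>i<b. n = A + 6 * b + 8 + 3 * i)"
proof -
  have A: "3 * t * b + 5 * t = A"
    by (simp add: assms algebra_simps)
  have two: "(\<exists>k. n = c + k * s \<and> k < 2) \<longleftrightarrow> n = c \<or> n = c + s" for c s :: nat
  proof -
    have "(\<exists>k. n = c + k * s \<and> k < 2) \<longleftrightarrow> (\<exists>k\<in>{0, 1}. n = c + k * s)"
      by (auto simp: less_2_cases_iff)
    then show ?thesis
      by simp
  qed
  show ?thesis
    unfolding uf_3bl_def sub_ula_def A Un_iff mem_Collect_eq two
    by (auto simp: mult.commute)
qed

lemma multiple_gap:
  fixes m x y :: nat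
  assumes "m dvd x" "m dvd y" "x < y"
  shows "x + m \<le> y"
  using assms by (metis add_le_cancel_left dvd_diff_nat dvd_imp_le le_add_diff_inverse
      less_imp_le zero_less_diff)

text \<open>The elements of sub-ULA3 are \<open>3b - 1 + x\<close> with \<open>x\<close> a positive multiple of the period
  \<open>3b + 5\<close> up to \<open>A\<close>. Of these multiples only the spacing is recorded, so that case
  distinctions stay within linear arithmetic.\<close>

lemma uf_3bl_cases:
  assumes "n \<in> uf_3bl b t" and A: "A = (3 * b + 5) * t"
  obtains (1) i where "i < b" "n = 3 * i" | (2) "n = 3 * b + 1" | (3) "n = 3 * b + 2"
  | (4) x where "n + 1 = 3 * b + x" "3 * b + 5 dvd x" "x = 3 * b + 5 \<or> 6 * b + 10 \<le> x"
      "x = A \<or> x + 3 * b + 5 \<le> A"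
  | (5) i where "i < b" "n = A + 3 * b + 2 + 3 * i" | (6) "n = A + 6 * b + 3" | (7) "n = A + 6 * b + 5"
  | (8) i where "i < b" "n = A + 6 * b + 8 + 3 * i"
proof -
  have "\<exists>x. n + 1 = 3 * b + x \<and> 3 * b + 5 dvd x \<and> (x = 3 * b + 5 \<or> 6 * b + 10 \<le> x) \<and>
      (x = A \<or> x + 3 * b + 5 \<le> A)"
    if j: "j < t" "n = 6 * b + 4 + (3 * b + 5) * j" for j
  proof (intro exI conjI)
    \<comment> \<open>The initial position \<open>6 * b + 4\<close> of sub-ULA3 is already
      \<open>3 * b - 1\<close> plus one period, hence the factor \<open>j + 1\<close>.\<close>
    let ?x = "(3 * b + 5) * (j + 1)"
    show "n + 1 = 3 * b + ?x"
      using j by (simp add: algebra_simps)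
    show dvd: "3 * b + 5 dvd ?x"
      by (rule dvd_triv_left)
    have "3 * b + 5 \<le> ?x"
      by simp
    with multiple_gap[OF dvd_refl dvd] show "?x = 3 * b + 5 \<or> 6 * b + 10 \<le> ?x"
      by linarith
    have "?x \<le> A"
      unfolding A using j by (intro mult_le_mono2) simp
    moreover have "3 * b + 5 dvd A"
      by (simp add: A)
    ultimately show "?x = A \<or> ?x + 3 * b + 5 \<le> A"
      using multiple_gap[OF dvd] by (metis add.assoc le_neq_implies_less)
  qed
  with assms(1) show thesis
    unfolding mem_uf_3bl_iff[OF A] using that by metis
qed

text \<open>The sub-ULAs occupy disjoint ranges in increasing order, so their sizes add up. The
  bound on \<open>t\<close> gives \<open>3 * b + 5 \<le> A\<close>, which keeps sub-ULA4 above
  sub-ULA2.\<close>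

lemma card_uf_3bl:
  assumes "t \<ge> 1"
  shows "card (uf_3bl b t) = 3 * b + t + 4"
proof -
  define A where "A = (3 * b + 5) * t"
  have A: "3 * t * b + 5 * t = A"
    by (simp add: A_def algebra_simps)
  have low: "n < 3 * b" if "n \<in> sub_ula 0 3 b" for n
    using that by (auto simp: sub_ula_def)
  have two: "n \<in> sub_ula c d 2 \<longleftrightarrow> n = c \<or> n = c + d" for n c d
    by (auto simp: sub_ula_def less_2_cases_iff)
  have mid: "6 * b + 4 \<le> n \<and> n + 1 \<le> A + 3 * b" if "n \<in> sub_ula (6 * b + 4) (3 * b + 5) t" for n
  proof -
    from that obtain j where j: "j < t" "n = 6 * b + 4 + j * (3 * b + 5)"
      by (auto simp: sub_ula_def)
    have "(j + 1) * (3 * b + 5) \<le> t * (3 * b + 5)"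
      using j(1) by (intro mult_le_mono1) simp
    then show ?thesis
      using j(2) by (simp add: A_def algebra_simps)
  qed
  have high: "c \<le> n \<and> n < c + 3 * b" if "n \<in> sub_ula c 3 b" for n c
    using that by (auto simp: sub_ula_def)
  have "3 * b + 5 \<le> A"
    using assms by (simp add: A_def)
  then show ?thesis
    unfolding uf_3bl_def A
    \<comment> \<open>Each round splits off the last remaining sub-ULA.\<close>
    apply (subst card_Un_disjoint; (simp only: finite_Un finite_sub_ula)?)
     apply (fastforce dest: low mid high simp: two)
    apply (subst card_Un_disjoint; (simp only: finite_Un finite_sub_ula)?)
     apply (fastforce dest: low mid high simp: two)
    apply (subst card_Un_disjoint; (simp only: finite_Un finite_sub_ula)?)
     apply (fastforce dest: low mid high simp: two)
    apply (subst card_Un_disjoint; (simp only: finite_Un finite_sub_ula)?)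
     apply (fastforce dest: low mid high simp: two)
    apply (subst card_Un_disjoint; (simp only: finite_Un finite_sub_ula)?)
     apply (fastforce dest: low mid high simp: two)
    by (simp add: card_sub_ula)
qed

section \<open>Difference coarray: initial segment and first hole\<close>

lemma dcaI: "p \<in> S \<Longrightarrow> q \<in> S \<Longrightarrow> int p = int q + d \<Longrightarrow> d \<in> dca S"
  by (force simp: dca_def)

lemma uminus_mem_dca: "d \<in> dca S \<Longrightarrow> - d \<in> dca S"
  by (force simp: dca_def)

text \<open>Every \<open>d \<le> J\<close> is \<open>(3b + 5) k + s - 3\<close> with \<open>s < 3b + 5\<close>.
  For \<open>s = 0, 1\<close> and \<open>s = 5, 8, \<dots>\<close> the difference is realized between sub-ULA3 and sub-ULA1 or 2,
  for the other \<open>s\<close> between sub-ULA4, 5 or 6 and sub-ULA3; the extreme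
  cases \<open>k = 0\<close> and \<open>k = t\<close>, where sub-ULA3 runs out, are covered by sub-ULA1, 2, 4 and 5 alone.\<close>

lemma initial_segment_dca_uf_3bl:
  assumes "b \<ge> 1" "t \<ge> 1" and d: "d < (3 * b + 5) * t + 3 * b"
  shows "int d \<in> dca (uf_3bl b t)"
proof -
  define M A where "M = 3 * b + 5" and "A = M * t"
  note mem = mem_uf_3bl_iff[of A b t, folded M_def, OF A_def]
  have I: "int d \<in> dca (uf_3bl b t)"
    if "p \<in> uf_3bl b t" "q \<in> uf_3bl b t" "p = q + d" for p q
    using dcaI[OF that(1,2)] that(3) by simp
  have ula1: "3 * i \<in> uf_3bl b t" if "i < b" for i
    using that by (auto simp: mem)
  have ula2: "3 * b + 1 \<in> uf_3bl b t" "3 * b + 2 \<in> uf_3bl b t"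
    by (auto simp: mem)
  have ula3: "\<exists>p \<in> uf_3bl b t. p + 1 = 3 * b + M * j" if "1 \<le> j" "j \<le> t" for j
  proof
    show "6 * b + 4 + M * (j - 1) \<in> uf_3bl b t"
      unfolding mem using that by (metis One_nat_def Suc_le_lessD diff_Suc_less less_le_trans diff_less zero_less_one)
    obtain j' where "j = Suc j'"
      using \<open>1 \<le> j\<close> by (cases j) auto
    then show "6 * b + 4 + M * (j - 1) + 1 = 3 * b + M * j"
      by (simp add: M_def)
  qed
  \<comment> \<open>Counts sub-ULA3 downwards from its last position
    \<open>A + 3 * b - 1\<close>.\<close>
  have ula3': "\<exists>q \<in> uf_3bl b t. q + 1 + M * j = 3 * b + A" if "j < t" for j
  proof -
    have "M * (t - j) + M * j = A"
      using that by (simp add: A_def flip: distrib_left)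
    with ula3[of "t - j"] that show ?thesis
      by auto
  qed
  have ula4: "A + 3 * b + 2 + 3 * i \<in> uf_3bl b t" if "i < b" for i
    using that by (auto simp: mem)
  have ula5: "A + 6 * b + 3 \<in> uf_3bl b t" "A + 6 * b + 5 \<in> uf_3bl b t"
    by (auto simp: mem)
  have ula6: "A + 6 * b + 8 + 3 * i \<in> uf_3bl b t" if "i < b" for i
    using that by (auto simp: mem)
  \<comment> \<open>With the shift by 3, the \<open>k\<close>-th position of sub-ULA3 minus
    \<open>d\<close> is \<open>3 * b + 2 - s\<close>, so \<open>s\<close> measures the distance
    below the end of sub-ULA2.\<close>
  define k s where "k = (d + 3) div M" and "s = (d + 3) mod M"
  have dks: "d + 3 = M * k + s" and s: "s < M"
    by (auto simp: k_def s_def M_def)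
  \<comment> \<open>The bound on \<open>d\<close> gives \<open>d + 3 < A + 3 * b + 3\<close>, while
    \<open>M * (t + 1) = A + 3 * b + 5\<close>.\<close>
  have "M * k < M * (t + 1)"
    using d dks by (simp add: M_def)
  then have kt: "k \<le> t"
    by (metis Suc_eq_plus1 less_Suc_eq_le mult_less_cancel1)
  have up: "\<exists>p \<in> uf_3bl b t. p + s = d + 3 * b + 2" if "1 \<le> k"
    using ula3[OF that kt] dks by force
  \<comment> \<open>Here \<open>q + d = A + 3 * b + s - 4\<close>, which is in sub-ULA4 for
    \<open>s = 6 + 3 * i\<close>.\<close>
  have down: "\<exists>q \<in> uf_3bl b t. q + d + 4 = 3 * b + A + s" if "k < t"
    using ula3'[OF that] dks by force
  \<comment> \<open>Taking \<open>q\<close> one period higher gives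
    \<open>q + d = A + 6 * b + s + 1\<close>: sub-ULA5 for \<open>s = 2\<close> and
    \<open>s = 4\<close>, sub-ULA6 for \<open>s = 7 + 3 * i\<close>.\<close>
  have down': "\<exists>q \<in> uf_3bl b t. q + d = 3 * b + A + s + 3 * b + 1" if k: "1 \<le> k"
  proof -
    have "M * (k - 1) + M = M * k"
      using k by (cases k) auto
    with ula3'[of "k - 1"] k kt dks show ?thesis
      by (force simp: M_def)
  qed
  \<comment> \<open>Consequently \<open>k = 0\<close> cannot occur for \<open>s < 3\<close>.\<close>
  have k0: "d + 3 = s" if "k = 0"
    using dks that by simp
  have kt': "d + 3 = A + s" if "k = t"
    using dks that by (simp add: A_def)
  have "s < 5 \<or> (\<exists>i. s = 5 + 3 * i \<or> s = 6 + 3 * i \<or> s = 7 + 3 * i)"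
    by presburger
  then consider "s = 0" | "s = 1" | "s = 2" | "s = 3" | "s = 4"
    | i where "s = 5 + 3 * i" | i where "s = 6 + 3 * i" | i where "s = 7 + 3 * i"
    by (auto simp: numeral_eq_Suc less_Suc_eq)
  then show ?thesis
  proof cases
    case 1
    with k0 obtain p where "p \<in> uf_3bl b t" "p + s = d + 3 * b + 2"
      using up by (cases "k = 0") auto
    with 1 ula2 show ?thesis
      by (intro I[of p "3 * b + 2"]) auto
  next
    case 2
    with k0 obtain p where "p \<in> uf_3bl b t" "p + s = d + 3 * b + 2"
      using up by (cases "k = 0") auto
    with 2 ula2 show ?thesis
      by (intro I[of p "3 * b + 1"]) auto
  next
    case 3
    with k0 obtain q where "q \<in> uf_3bl b t" "q + d = 3 * b + A + s + 3 * b + 1"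
      using down' by (cases "k = 0") auto
    with 3 ula5 show ?thesis
      by (intro I[of "A + 6 * b + 3" q]) auto
  next
    case 4
    show ?thesis
    proof (cases "k = 0")
      case True
      with 4 k0 ula2 show ?thesis
        by (intro I[of "3 * b + 1" "3 * b + 1"]) auto
    next
      case False
      show ?thesis
      proof (cases "k = t")
        case True
        with 4 kt' ula4[of 0] ula2 assms show ?thesis
          by (intro I[of "A + 3 * b + 2" "3 * b + 2"]) auto
      next
        case False
        \<comment> \<open>Now \<open>d = M * k\<close> with \<open>0 < k < t\<close> is a multiple
          of the period, realized inside sub-ULA3.\<close>
        with kt ula3[of t] down 4 \<open>t \<ge> 1\<close> obtain p q where
          "p \<in> uf_3bl b t" "p + 1 = 3 * b + A"
          "q \<in> uf_3bl b t" "q + d + 4 = 3 * b + A + s"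
          by (auto simp: A_def)
        with 4 show ?thesis
          by (intro I[of p q]) auto
      qed
    qed
  next
    case 5
    show ?thesis
    proof (cases "k = 0")
      case True
      with 5 k0 ula2 show ?thesis
        by (intro I[of "3 * b + 2" "3 * b + 1"]) auto
    next
      case False
      with down' obtain q where "q \<in> uf_3bl b t" "q + d = 3 * b + A + s + 3 * b + 1"
        by auto
      with 5 ula5 show ?thesis
        by (intro I[of "A + 6 * b + 5" q]) auto
    qed
  next
    case (6 i)
    with s have i: "i < b"
      by (simp add: M_def)
    consider "k = 0" "i = 0" | "k = 0" "i \<ge> 1" | "k \<ge> 1"
      by linarith
    then show ?thesis
    proof cases
      case 1
      \<comment> \<open>This is \<open>d = 2\<close>, the internal gap of sub-ULA5.\<close>
      with 6 k0 ula5 show ?thesis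
        by (intro I[of "A + 6 * b + 5" "A + 6 * b + 3"]) auto
    next
      case 2
      with 6 i k0 ula2 ula1[of "b - i"] show ?thesis
        by (intro I[of "3 * b + 2" "3 * (b - i)"]) auto
    next
      case 3
      with up obtain p where "p \<in> uf_3bl b t" "p + s = d + 3 * b + 2"
        by auto
      with 6 i ula1[of "b - 1 - i"] show ?thesis
        by (intro I[of p "3 * (b - 1 - i)"]) auto
    qed
  next
    case (7 i)
    with s have i: "i < b"
      by (simp add: M_def)
    show ?thesis
    proof (cases "k = t")
      case True
      \<comment> \<open>The bound on \<open>d\<close> excludes \<open>i = b - 1\<close>, which would
        be the hole \<open>A + 3 * b\<close>.\<close>
      with 7 kt' d have "d = A + 3 * (i + 1)" "i + 1 < b"
        by (auto simp: A_def M_def)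
      with ula4[of "i + 1"] ula2 show ?thesis
        by (intro I[of "A + 3 * b + 2 + 3 * (i + 1)" "3 * b + 2"]) auto
    next
      case False
      with kt down obtain q where "q \<in> uf_3bl b t" "q + d + 4 = 3 * b + A + s"
        by auto
      with 7 i ula4 show ?thesis
        by (intro I[of "A + 3 * b + 2 + 3 * i" q]) auto
    qed
  next
    case (8 i)
    with s have i: "i < b"
      by (simp add: M_def)
    show ?thesis
    proof (cases "k = 0")
      case True
      with 8 k0 i ula2 ula1[of "b - 1 - i"] show ?thesis
        by (intro I[of "3 * b + 1" "3 * (b - 1 - i)"]) auto
    next
      case False
      with down' obtain q where "q \<in> uf_3bl b t" "q + d = 3 * b + A + s + 3 * b + 1"
        by auto
      with 8 i ula6 show ?thesis
        by (intro I[of "A + 6 * b + 8 + 3 * i" q]) auto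
    qed
  qed
qed

text \<open>Linear arithmetic refutes 62 of the 64 combinations of cases for \<open>p\<close> and
  \<open>q\<close>. The other two, sub-ULA4 minus sub-ULA1 and sub-ULA6 minus sub-ULA3, fail modulo
  3.\<close>

lemma first_hole_dca_uf_3bl:
  assumes "b \<ge> 1" "t \<ge> 1"
  shows "int ((3 * b + 5) * t + 3 * b) \<notin> dca (uf_3bl b t)"
proof
  define A where "A = (3 * b + 5) * t"
  assume "int ((3 * b + 5) * t + 3 * b) \<in> dca (uf_3bl b t)"
  then obtain p q where pq: "p \<in> uf_3bl b t" "q \<in> uf_3bl b t" and "int p - int q = int (A + 3 * b)"
    unfolding dca_def A_def[symmetric] by force
  then have p: "p = q + A + 3 * b"
    by linarith
  have A: "3 * b + 5 \<le> A"
    using assms by (simp add: A_def)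
  show False
    using pq(1) A_def pq(2) A_def
  proof (cases rule: uf_3bl_cases[case_product uf_3bl_cases])
    case ("5_1" i i')
    with p have "2 + 3 * i = 3 * i'"
      by linarith
    then show ?thesis
      by presburger
  next
    case ("8_4" i x)
    \<comment> \<open>Here \<open>x = 3 * i + 9 \<le> 3 * b + 6\<close>, below the second multiple
      of the period.\<close>
    with p have "x = 3 * b + 5"
      by linarith
    with "8_4" p have "3 * i + 4 = 3 * b"
      by linarith
    then show ?thesis
      by presburger
  qed (use p A assms(1) in \<open>linarith+\<close>)
qed

section \<open>Weight function at 1, 2 and 3\<close>

lemma weight_eq_card_shift: "weight S (int d) = card {q \<in> S. q + d \<in> S}"
proof -
  have "{(p, q). p \<in> S \<and> q \<in> S \<and> int p - int q = int d} = (\<lambda>q. (q + d, q)) ` {q \<in> S. q + d \<in> S}"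
  proof (intro equalityI subsetI; clarify)
    fix p q assume "p \<in> S" "q \<in> S" "int p - int q = int d"
    moreover from this have "p = q + d"
      by linarith
    ultimately show "(p, q) \<in> (\<lambda>q. (q + d, q)) ` {q \<in> S. q + d \<in> S}"
      by auto
  qed simp
  then show ?thesis
    by (simp add: weight_def card_image inj_on_def)
qed

text \<open>One enumeration serves all three weights. Differences up to 3 arise inside every sub-ULA
  except sub-ULA3, and where sub-ULA3 meets sub-ULA4 and sub-ULA5 meets sub-ULA6. Only ranges are
  recorded; residues modulo 3 are recovered later from \<open>q\<close> being in the array.\<close>

lemma close_pairs_uf_3bl:
  assumes "b \<ge> 1" "t \<ge> 1" and A: "A = (3 * b + 5) * t" and d: "1 \<le> d" "d \<le> 3"
    and q: "q \<in> uf_3bl b t" "q + d \<in> uf_3bl b t"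
  shows "d = 1 \<and> q = 3 * b + 1 \<or> d = 2 \<and> q = A + 6 * b + 3 \<or>
    d = 3 \<and> (q + 3 < 3 * b \<or> q + 1 = A + 3 * b \<or> A + 3 * b + 2 \<le> q \<and> q + 3 < A + 6 * b + 2 \<or>
      q = A + 6 * b + 5 \<or> A + 6 * b + 8 \<le> q \<and> q + 3 < A + 9 * b + 8)"
proof -
  have A': "3 * b + 5 \<le> A"
    using \<open>t \<ge> 1\<close> by (simp add: A)
  have gap: "x = y \<or> x + 3 * b + 5 \<le> y \<or> y + 3 * b + 5 \<le> x"
    if "3 * b + 5 dvd x" "3 * b + 5 dvd y" for x y
    using multiple_gap[OF that] multiple_gap[OF that(2,1)] by linarith
  show ?thesis
    using q(1) A q(2) A
  proof (cases rule: uf_3bl_cases[case_product uf_3bl_cases])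
    case ("1_1" i j)
    with d have "d = 3" "q + 3 < 3 * b"
      by presburger+
    then show ?thesis
      by blast
  next
    case "2_3"
    then show ?thesis
      by auto
  next
    case ("4_4" x y)
    then have "y = x + d"
      by linarith
    with gap[OF "4_4"(2,6)] d have False
      by linarith
    then show ?thesis ..
  next
    case ("4_5" x i)
    \<comment> \<open>Only the last position of sub-ULA3, \<open>x = A\<close>, is close enough to
      sub-ULA4.\<close>
    with A' d have "d = 3" "q + 1 = A + 3 * b"
      by linarith+
    then show ?thesis
      by blast
  next
    case ("5_5" i j)
    with d have "d = 3" "A + 3 * b + 2 \<le> q" "q + 3 < A + 6 * b + 2"
      by presburger+
    then show ?thesis
      by blast
  next
    case "6_7"
    then show ?thesis
      by auto
  next
    case ("7_8" i)
    with d have "d = 3" "q = A + 6 * b + 5"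
      by linarith+
    then show ?thesis
      by blast
  next
    case ("8_8" i j)
    with d have "d = 3" "A + 6 * b + 8 \<le> q" "q + 3 < A + 9 * b + 8"
      by presburger+
    then show ?thesis
      by blast
  qed (rule FalseE, use A' d assms(1) in linarith)+
qed

lemma weight_1_uf_3bl:
  assumes "b \<ge> 1" "t \<ge> 1"
  shows "weight (uf_3bl b t) 1 = 1"
proof -
  have "3 * b + 1 \<in> uf_3bl b t" "3 * b + 1 + 1 \<in> uf_3bl b t"
    unfolding mem_uf_3bl_iff[OF refl] by simp_all
  then have "{q \<in> uf_3bl b t. q + 1 \<in> uf_3bl b t} = {3 * b + 1}"
    using close_pairs_uf_3bl[OF assms refl, of 1] by fastforce
  then show ?thesis
    using weight_eq_card_shift[of "uf_3bl b t" 1] by simp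
qed

lemma weight_2_uf_3bl:
  assumes "b \<ge> 1" "t \<ge> 1"
  shows "weight (uf_3bl b t) 2 = 1"
proof -
  define A where "A = (3 * b + 5) * t"
  have "A + 6 * b + 3 \<in> uf_3bl b t" "A + 6 * b + 3 + 2 \<in> uf_3bl b t"
    unfolding mem_uf_3bl_iff[OF A_def] by simp_all
  then have "{q \<in> uf_3bl b t. q + 2 \<in> uf_3bl b t} = {A + 6 * b + 3}"
    using close_pairs_uf_3bl[OF assms A_def, of 2] by fastforce
  then show ?thesis
    using weight_eq_card_shift[of "uf_3bl b t" 2] by simp
qed

text \<open>The lower members form three progressions of step 3: sub-ULA1 without its last position,
  and sub-ULA4 and sub-ULA6 likewise, each preceded by the last position of sub-ULA3 or sub-ULA5,
  which lies 3 below. This gives \<open>(b - 1) + b + b\<close>.\<close>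

lemma weight_3_uf_3bl:
  assumes "b \<ge> 1" "t \<ge> 1"
  shows "weight (uf_3bl b t) 3 = 3 * b - 1"
proof -
  define A where "A = (3 * b + 5) * t"
  have A: "A \<ge> 3 * b + 5"
    using assms by (simp add: A_def)
  note mem = mem_uf_3bl_iff[OF A_def]
  have ula: "n \<in> sub_ula c 3 N \<longleftrightarrow> (\<exists>i<N. n = c + 3 * i)" for n c N
    by (auto simp: sub_ula_def)
  have ula3_last: "A + 3 * b - 1 \<in> uf_3bl b t"
  proof -
    have "A + 3 * b - 1 = 6 * b + 4 + (3 * b + 5) * (t - 1)"
      using assms by (cases t) (auto simp: A_def)
    with \<open>t \<ge> 1\<close> show ?thesis
      unfolding mem by auto
  qed
  have "{q \<in> uf_3bl b t. q + 3 \<in> uf_3bl b t} =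
      sub_ula 0 3 (b - 1) \<union> sub_ula (A + 3 * b - 1) 3 b \<union> sub_ula (A + 6 * b + 5) 3 b"
    (is "?L = ?R")
  proof (intro equalityI subsetI)
    fix q assume "q \<in> ?L"
    then have q: "q \<in> uf_3bl b t" "q + 3 \<in> uf_3bl b t"
      by auto
    have *: "q + 3 < 3 * b \<or> q + 1 = A + 3 * b \<or> A + 3 * b + 2 \<le> q \<and> q + 3 < A + 6 * b + 2 \<or>
      q = A + 6 * b + 5 \<or> A + 6 * b + 8 \<le> q \<and> q + 3 < A + 9 * b + 8"
      using close_pairs_uf_3bl[OF assms A_def _ _ q] by auto
    have "(\<exists>i<b - 1. q = 3 * i) \<or> (\<exists>i<b. q = A + 3 * b - 1 + 3 * i) \<or> (\<exists>i<b. q = A + 6 * b + 5 + 3 * i)"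
      using q(1) A_def
    proof (cases rule: uf_3bl_cases)
      case (1 i)
      with * A have "i < b - 1"
        by linarith
      with 1 show ?thesis
        by auto
    next
      case (4 x)
      with * A have "q + 1 = A + 3 * b"
        by linarith
      \<comment> \<open>Index 0 is the end of sub-ULA3; sub-ULA4 contributes the indices from 1
        on.\<close>
      then have "q = A + 3 * b - 1 + 3 * 0"
        by simp
      with assms show ?thesis
        by (metis One_nat_def Suc_le_lessD)
    next
      case (5 i)
      with * A have "i + 1 < b"
        by linarith
      moreover have "q = A + 3 * b - 1 + 3 * (i + 1)"
        using 5(2) A by simp
      ultimately show ?thesis
        by blast
    next
      case 7
      then have "q = A + 6 * b + 5 + 3 * 0"
        by simp
      with assms show ?thesis
        by (metis One_nat_def Suc_le_lessD)
    next
      case (8 i)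
      with * A have "i + 1 < b"
        by linarith
      moreover have "q = A + 6 * b + 5 + 3 * (i + 1)"
        using 8(2) by simp
      ultimately show ?thesis
        by blast
    qed (rule FalseE, use * A in linarith)+
    then show "q \<in> ?R"
      by (auto simp: ula)
  next
    have ula1: "3 * i \<in> uf_3bl b t" if "i < b" for i
      using that by (auto simp: mem)
    have ula4: "A + 3 * b + 2 + 3 * i \<in> uf_3bl b t" if "i < b" for i
      using that by (auto simp: mem)
    have ula6: "A + 6 * b + 8 + 3 * i \<in> uf_3bl b t" if "i < b" for i
      using that by (auto simp: mem)
    have ula5: "A + 6 * b + 5 \<in> uf_3bl b t"
      by (auto simp: mem)
    fix q assume "q \<in> ?R"
    then consider i where "i < b - 1" "q = 3 * i" | i where "i < b" "q = A + 3 * b - 1 + 3 * i"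
      | i where "i < b" "q = A + 6 * b + 5 + 3 * i"
      by (auto simp: ula)
    then show "q \<in> ?L"
    proof cases
      case (1 i)
      then have "q + 3 = 3 * (i + 1)" "i + 1 < b" "i < b"
        by auto
      with 1 ula1 show ?thesis
        by (metis (lifting) mem_Collect_eq)
    next
      case (2 i)
      with A have "q + 3 = A + 3 * b + 2 + 3 * i"
        by linarith
      moreover have "q \<in> uf_3bl b t"
      proof (cases i)
        case 0
        with 2 ula3_last show ?thesis
          by simp
      next
        case (Suc j)
        with 2 A have "q = A + 3 * b + 2 + 3 * j" "j < b"
          by linarith+
        with ula4 show ?thesis
          by simp
      qed
      ultimately show ?thesis
        using ula4[OF 2(1)] by (metis (lifting) mem_Collect_eq)
    next
      case (3 i)
      then have "q + 3 = A + 6 * b + 8 + 3 * i"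
        by linarith
      moreover have "q \<in> uf_3bl b t"
      proof (cases i)
        case 0
        with 3 ula5 show ?thesis
          by simp
      next
        case (Suc j)
        with 3 have "q = A + 6 * b + 8 + 3 * j" "j < b"
          by linarith+
        with ula6 show ?thesis
          by simp
      qed
      ultimately show ?thesis
        using ula6[OF 3(1)] by (metis (lifting) mem_Collect_eq)
    qed
  qed
  moreover have "card ?R = (b - 1) + b + b"
    using A by (subst card_Un_disjoint | auto simp: finite_sub_ula ula card_sub_ula)+
  ultimately show ?thesis
    using weight_eq_card_shift[of "uf_3bl b t" 3] assms by simp
qed

section \<open>Central ULA and uDOF\<close>

lemma uf_3bl_J_eq: "uf_3bl_J b t = int ((3 * b + 5) * t + 3 * b) - 1"
  by (simp add: uf_3bl_J_def algebra_simps)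

text \<open>A longer segment would contain the first hole, which sits directly above
  \<open>uf_3bl_J b t\<close>.\<close>

lemma atLeastAtMost_subset_dca_uf_3bl_iff:
  assumes "b \<ge> 1" "t \<ge> 1"
  shows "{0..K} \<subseteq> dca (uf_3bl b t) \<longleftrightarrow> K \<le> uf_3bl_J b t"
proof
  assume "{0..K} \<subseteq> dca (uf_3bl b t)"
  moreover have "0 \<le> int ((3 * b + 5) * t + 3 * b)"
    by (rule of_nat_0_le_iff)
  ultimately have "\<not> int ((3 * b + 5) * t + 3 * b) \<le> K"
    using first_hole_dca_uf_3bl[OF assms] by (meson atLeastAtMost_iff subsetD)
  then show "K \<le> uf_3bl_J b t"
    unfolding uf_3bl_J_eq by linarith
next
  assume K: "K \<le> uf_3bl_J b t"
  show "{0..K} \<subseteq> dca (uf_3bl b t)"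
  proof
    fix d assume "d \<in> {0..K}"
    with K have "0 \<le> d" "d < int ((3 * b + 5) * t + 3 * b)"
      unfolding uf_3bl_J_eq by simp_all
    then have "0 \<le> d" "nat d < (3 * b + 5) * t + 3 * b"
      by linarith+
    with initial_segment_dca_uf_3bl[OF assms, of "nat d"] show "d \<in> dca (uf_3bl b t)"
      by simp
  qed
qed

text \<open>The coarray is symmetric about 0, so its nonnegative half determines the central ULA.
  The hypothesis \<open>0 \<le> J\<close> makes \<open>nat J\<close> the exact value of the
  \<open>GREATEST\<close> operator.\<close>

lemma uDOF_eq:
  assumes "0 \<le> J" and max: "\<And>K. {0..K} \<subseteq> dca S \<longleftrightarrow> K \<le> J"
  shows "int (uDOF S) = 2 * J + 1"
proof -
  have sym: "{- int k..int k} \<subseteq> dca S \<longleftrightarrow> int k \<le> J" for k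
  proof
    assume "{- int k..int k} \<subseteq> dca S"
    then show "int k \<le> J"
      unfolding max[symmetric] by force
  next
    assume "int k \<le> J"
    then have pos: "{0..int k} \<subseteq> dca S"
      unfolding max .
    show "{- int k..int k} \<subseteq> dca S"
    proof
      fix d assume "d \<in> {- int k..int k}"
      then have "d \<in> {0..int k} \<or> - d \<in> {0..int k}"
        by auto
      then have "d \<in> dca S \<or> - d \<in> dca S"
        using pos by blast
      then show "d \<in> dca S"
        using uminus_mem_dca[of "- d" S] by auto
    qed
  qed
  have "(GREATEST k :: nat. {- int k..int k} \<subseteq> dca S) = nat J"
    unfolding sym using assms(1) by (intro Greatest_equality) auto
  then show ?thesis
    using assms(1) by (simp add: uDOF_def central_ula_def)
qed

lemma uDOF_uf_3bl:
  assumes "b \<ge> 1" "t \<ge> 1"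
  shows "int (uDOF (uf_3bl b t)) = 2 * uf_3bl_J b t + 1"
proof (rule uDOF_eq)
  have "1 \<le> int t" "0 \<le> 3 * int b * int t"
    using assms by simp_all
  then show "0 \<le> uf_3bl_J b t"
    unfolding uf_3bl_J_def by linarith
qed (rule atLeastAtMost_subset_dca_uf_3bl_iff[OF assms])

section \<open>Optimal parameters for a given number of sensors\<close>

text \<open>Under the constraint, \<open>J = (3b + 5)(N - 3 - 3b) - 6\<close> is a concave quadratic in \<open>b\<close>. With \<open>u\<close>
  the deviation of \<open>b\<close> from the claimed optimum and \<open>r = (N - 5) mod 6\<close>, the loss in \<open>J\<close>
  is \<open>3u(3u + 3 - r)\<close>, which is nonnegative for every integer \<open>u\<close>.\<close>

lemma uf_3bl_J_le_optimum:
  assumes "3 * b0 + t0 + 4 = N" "3 * b + t + 4 = N" "N = 6 * b0 + 5 + r" "r < 6"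
  shows "uf_3bl_J b t \<le> uf_3bl_J b0 t0"
proof -
  define u where "u = int b - int b0"
  have t: "int t0 = 3 * int b0 + 1 + int r" "int t = 3 * int b0 + 1 + int r - 3 * u"
    "int b = int b0 + u"
    using assms by (auto simp: u_def)
  have "uf_3bl_J b0 t0 - uf_3bl_J b t = 3 * (u * (3 * u + 3 - int r))"
    unfolding uf_3bl_J_def t by (simp add: algebra_simps)
  moreover have "u * (3 * u + 3 - int r) \<ge> 0"
  \<comment> \<open>Both factors share a sign: \<open>u \<ge> 1\<close> gives
    \<open>3 * u + 3 - r \<ge> 6 - r > 0\<close>, and \<open>u \<le> - 1\<close> gives
    \<open>3 * u + 3 - r \<le> - r \<le> 0\<close>.\<close>
  proof (cases "u \<ge> 1")
    case True
    with \<open>r < 6\<close> show ?thesis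
      by (intro mult_nonneg_nonneg) auto
  next
    case False
    then have "u = 0 \<or> u \<le> - 1"
      by linarith
    then show ?thesis
      by (elim disjE) (simp_all add: mult_nonpos_nonpos)
  qed
  ultimately show ?thesis
    by linarith
qed

text \<open>One formula covers all residues: \<open>r * (6 - r)\<close> agrees for
  \<open>r = 1, 5\<close> and for \<open>r = 2, 4\<close>, which is why \<open>N mod 6\<close>
  groups into \<open>{0, 4}\<close> and \<open>{1, 3}\<close>, with 2 and 5 left alone.\<close>

lemma uDOF_uf_3bl_optimum:
  assumes "b \<ge> 1" "t \<ge> 1" "3 * b + t + 4 = N" "N = 6 * b + 5 + r"
  shows "real (uDOF (uf_3bl b t)) =
    (real N)\<^sup>2 / 2 + 2 * real N + (real r * (6 - real r) - 27) / 2"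
proof -
  have t: "real N = 6 * real b + 5 + real r" "real t = 3 * real b + 1 + real r"
    using assms by auto
  have "real (uDOF (uf_3bl b t)) = of_int (int (uDOF (uf_3bl b t)))"
    by simp
  then show ?thesis
    unfolding uDOF_uf_3bl[OF assms(1,2)] uf_3bl_J_def
    by (simp add: t power2_eq_square field_simps)
qed

theorem mainTheorem1:
  shows
    "(\<forall>Nb Nt :: nat. Nb \<ge> 1 \<longrightarrow> Nt \<ge> 1 \<longrightarrow>
        card (uf_3bl Nb Nt) = 3 * Nb + Nt + 4 \<and>
        {0 .. uf_3bl_J Nb Nt} \<subseteq> dca (uf_3bl Nb Nt) \<and>
        (\<forall>K :: int. {0 .. K} \<subseteq> dca (uf_3bl Nb Nt) \<longrightarrow> K \<le> uf_3bl_J Nb Nt) \<and>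
        int (uDOF (uf_3bl Nb Nt)) = 2 * uf_3bl_J Nb Nt + 1 \<and>
        weight (uf_3bl Nb Nt) 1 = 1 \<and>
        weight (uf_3bl Nb Nt) 2 = 1 \<and>
        int (weight (uf_3bl Nb Nt) 3) = 3 * int Nb - 1) \<and>
     (\<forall>N Nb Nt :: nat. N \<ge> 17 \<longrightarrow> Nb = (N - 5) div 6 \<longrightarrow> Nt = N - 3 * Nb - 4 \<longrightarrow>
        Nb \<ge> 1 \<and> Nt \<ge> 1 \<and> 3 * Nb + Nt + 4 = N \<and>
        (\<forall>b t :: nat. b \<ge> 1 \<longrightarrow> t \<ge> 1 \<longrightarrow> 3 * b + t + 4 = N \<longrightarrow>
           uf_3bl_J b t \<le> uf_3bl_J Nb Nt) \<and>
        (N mod 6 \<in> {0, 4} \<longrightarrow>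
           real (uDOF (uf_3bl Nb Nt)) = (real N)\<^sup>2 / 2 + 2 * real N - 11) \<and>
        (N mod 6 \<in> {1, 3} \<longrightarrow>
           real (uDOF (uf_3bl Nb Nt)) = (real N)\<^sup>2 / 2 + 2 * real N - 19 / 2) \<and>
        (N mod 6 = 2 \<longrightarrow>
           real (uDOF (uf_3bl Nb Nt)) = (real N)\<^sup>2 / 2 + 2 * real N - 9) \<and>
        (N mod 6 = 5 \<longrightarrow>
           real (uDOF (uf_3bl Nb Nt)) = (real N)\<^sup>2 / 2 + 2 * real N - 27 / 2))"
proof (intro conjI allI impI)
  fix b t :: nat assume bt: "b \<ge> 1" "t \<ge> 1"
  show "card (uf_3bl b t) = 3 * b + t + 4"
    using bt(2) by (rule card_uf_3bl)
  show "{0..uf_3bl_J b t} \<subseteq> dca (uf_3bl b t)"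
    using bt by (simp add: atLeastAtMost_subset_dca_uf_3bl_iff)
  show "K \<le> uf_3bl_J b t" if "{0..K} \<subseteq> dca (uf_3bl b t)" for K
    using that bt by (simp add: atLeastAtMost_subset_dca_uf_3bl_iff)
  show "int (uDOF (uf_3bl b t)) = 2 * uf_3bl_J b t + 1"
    using bt by (rule uDOF_uf_3bl)
  show "weight (uf_3bl b t) 1 = 1" "weight (uf_3bl b t) 2 = 1"
    using bt by (rule weight_1_uf_3bl weight_2_uf_3bl)+
  show "int (weight (uf_3bl b t) 3) = 3 * int b - 1"
    using weight_3_uf_3bl[OF bt] bt by simp
next
  fix N b0 t0 :: nat
  assume N: "N \<ge> 17" and b0: "b0 = (N - 5) div 6" and t0: "t0 = N - 3 * b0 - 4"
  define r where "r = (N - 5) mod 6"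
  have Nr: "N = 6 * b0 + 5 + r"
    unfolding r_def b0 using N mult_div_mod_eq[of 6 "N - 5"] by linarith
  have "r < 6"
    by (simp add: r_def)
  \<comment> \<open>Substituting \<open>N\<close> gives \<open>t0 = 3 * b0 + 1 + r\<close>.\<close>
  show pos: "b0 \<ge> 1" "t0 \<ge> 1" and sum: "3 * b0 + t0 + 4 = N"
    using N t0 Nr \<open>r < 6\<close> by linarith+
  show "uf_3bl_J b t \<le> uf_3bl_J b0 t0" if "3 * b + t + 4 = N" for b t
    using uf_3bl_J_le_optimum[OF sum that Nr \<open>r < 6\<close>] .
  note uDOF = uDOF_uf_3bl_optimum[OF pos sum Nr]
  have "N mod 6 = (6 * b0 + (5 + r)) mod 6"
    by (simp only: Nr add.assoc)
  then have Nmod: "N mod 6 = (5 + r) mod 6"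
    by (simp only: mod_mult_self4)
  have r: "r = 0 \<or> r = 1 \<or> r = 2 \<or> r = 3 \<or> r = 4 \<or> r = 5"
    using \<open>r < 6\<close> by linarith
  show "real (uDOF (uf_3bl b0 t0)) = (real N)\<^sup>2 / 2 + 2 * real N - 11" if "N mod 6 \<in> {0, 4}"
    using that r unfolding Nmod uDOF by auto
  show "real (uDOF (uf_3bl b0 t0)) = (real N)\<^sup>2 / 2 + 2 * real N - 19 / 2" if "N mod 6 \<in> {1, 3}"
    using that r unfolding Nmod uDOF by auto
  show "real (uDOF (uf_3bl b0 t0)) = (real N)\<^sup>2 / 2 + 2 * real N - 9" if "N mod 6 = 2"
    using that r unfolding Nmod uDOF by auto
  show "real (uDOF (uf_3bl b0 t0)) = (real N)\<^sup>2 / 2 + 2 * real N - 27 / 2" if "N mod 6 = 5"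
    using that r unfolding Nmod uDOF by auto
qed

end
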